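(* Let $n=m\ge 1$, let $\mathbf{x}=(x_1,\dots,x_n)\in\mathbb{R}^n$, let $\mathbf{a}=\mathbf{b}=\mathbf{1}_n/n$, and let $\xi=\sum_{i=1}^n a_i\delta_{x_i}=\frac1n\sum_{i=1}^n\delta_{x_i}$. Then for all strictly convex functions $h:\mathbb{R}\to\mathbb{R}_+$ and all $\mathbf{y}=(y_1,\dots,y_n)\in\mathbb{O}_n$ (with $y_1<\dots<y_n$), if $P_\star$ is an optimal solution of $$\min_{P\in U(\mathbf{a},\mathbf{b})}\ \sum_{i=1}^n\sum_{j=1}^n P_{ij}\,h(y_j-x_i),\qquad U(\mathbf{a},\mathbf{b})=\{P\in\mathbb{R}_+^{n\times n}: P\mathbf{1}_n=\mathbf{a},\ P^T\mathbf{1}_n=\mathbf{b}\},$$ then $$R(\mathbf{x})=n^2P_\star\overline{\mathbf{b}}=nP_\star\begin{bmatrix}1\\ \vdots\\ n\end{bmatrix}=nF_\xi(\mathbf{x}),\qquad S(\mathbf{x})=nP_\star^T\mathbf{x}=Q_\xi(\overline{\mathbf{b}})\in\mathbb{O}_n.$$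
   Context: $\mathbf{1}_n$ is the $n$-vector of ones and $\delta_x$ is the Dirac measure at $x$. $\mathbb{O}_n\subset\mathbb{R}^n$ is the set of increasing vectors of size $n$. For $\mathbf{c}\in\mathbb{R}^n$, $\overline{\mathbf{c}}=(c_1+\dots+c_i)_{i=1}^n$ is its vector of cumulative sums; thus $\overline{\mathbf{b}}=(1/n,2/n,\dots,1)$ when $\mathbf{b}=\mathbf{1}_n/n$. The integer $n$ is the size of $\mathbf{x}$ and $m$ is the size of $\mathbf{y}$. Sorting $\mathbf{x}\in\mathbb{R}^n$ means finding a permutation $\sigma$ of $\{1,\dots,n\}$ such that $\mathbf{x}_\sigma=(x_{\sigma_1},\dots,x_{\sigma_n})$ is increasing. The vector of sorted values is $S(\mathbf{x})=\mathbf{x}_\sigma$, and the vector of ranks is the inverse of the sorting permutation, $R(\mathbf{x})=\sigma^{-1}$, which lists the rank of each entry of $\mathbf{x}$ (rank $1$ for the smallest entry). For a probability measure $\xi$ on $\mathbb{R}$, $F_\xi(t)=\xi((-\infty,t])$ is its cumulative distribution function and $Q_\xi(u)=\inf\{t\in\mathbb{R}: F_\xi(t)\ge u\}$, $u\in(0,1]$, is its (generalized) quantile function. Functions are applied to vectors entrywise.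
   Formalization: The rank chain R(x) = n²P⋆b̄ = nP⋆(1,…,n)ᵀ = nF_ξ(x) is stated only for x with pairwise distinct entries, since it fails for every x with ties (e.g. x=(0,0) gives nF_ξ(x)=(2,2)); the S(x) chain is stated for all x. *)

theory Defs
  imports
    "HOL-Probability.Probability"
    "HOL-Combinatorics.Permutations"
    "Jordan_Normal_Form.Matrix"
begin

unbundle no vec_syntax
hide_type (open) Finite_Cartesian_Product.vec
hide_const (open) Finite_Cartesian_Product.vec Finite_Cartesian_Product.mat
  Finite_Cartesian_Product.row Finite_Cartesian_Product.column
  Finite_Cartesian_Product.transpose

text \<open>
  Vectors and matrices carry their dimension explicitly and are indexed from 0: the entry with
  index \<open>i < n\<close> is the mathematical entry number \<open>Suc i\<close>, and permutations act on \<open>{..<n}\<close>.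
\<close>

definition ones_vec :: "nat \<Rightarrow> real vec" where
  "ones_vec n = vec n (\<lambda>_. 1)"

definition increasing_vecs :: "nat \<Rightarrow> real vec set" where
  "increasing_vecs n = {v \<in> carrier_vec n. mono_on {..<n} (($) v)}"

definition strictly_increasing_vec :: "real vec \<Rightarrow> bool" where
  "strictly_increasing_vec v \<longleftrightarrow> strict_mono_on {..<dim_vec v} (($) v)"

definition cumsum_vec :: "real vec \<Rightarrow> real vec" where
  "cumsum_vec c = vec (dim_vec c) (\<lambda>i. \<Sum>k\<le>i. c $ k)"

definition permute_vec :: "real vec \<Rightarrow> (nat \<Rightarrow> nat) \<Rightarrow> real vec" where
  "permute_vec x \<sigma> = vec (dim_vec x) (\<lambda>i. x $ \<sigma> i)"

definition sorting_perm :: "real vec \<Rightarrow> (nat \<Rightarrow> nat) \<Rightarrow> bool" where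
  "sorting_perm x \<sigma> \<longleftrightarrow>
     \<sigma> permutes {..<dim_vec x} \<and> permute_vec x \<sigma> \<in> increasing_vecs (dim_vec x)"

text \<open>The permutation \<open>\<sigma>\<close> of \<open>{..<n}\<close> as the vector of its values, shifted to \<open>{1..n}\<close>.\<close>

definition perm_vec :: "nat \<Rightarrow> (nat \<Rightarrow> nat) \<Rightarrow> real vec" where
  "perm_vec n \<sigma> = vec n (\<lambda>i. real (Suc (\<sigma> i)))"

definition transport_polytope :: "real vec \<Rightarrow> real vec \<Rightarrow> real mat set" where
  "transport_polytope a b =
     {P \<in> carrier_mat (dim_vec a) (dim_vec b).
        (\<forall>i < dim_vec a. \<forall>j < dim_vec b. 0 \<le> P $$ (i, j)) \<and>
        P *\<^sub>v ones_vec (dim_vec b) = a \<and>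
        transpose_mat P *\<^sub>v ones_vec (dim_vec a) = b}"

definition transport_cost :: "(real \<Rightarrow> real) \<Rightarrow> real vec \<Rightarrow> real vec \<Rightarrow> real mat \<Rightarrow> real" where
  "transport_cost h x y P =
     (\<Sum>i<dim_vec x. \<Sum>j<dim_vec y. P $$ (i, j) * h (y $ j - x $ i))"

definition strictly_convex :: "(real \<Rightarrow> real) \<Rightarrow> bool" where
  "strictly_convex h \<longleftrightarrow>
     (\<forall>s t u. s \<noteq> t \<longrightarrow> 0 < u \<longrightarrow> u < 1 \<longrightarrow>
        h ((1 - u) * s + u * t) < (1 - u) * h s + u * h t)"

text \<open>The Dirac measure at \<open>t\<close> on the reals is \<open>return borel t\<close>.\<close>

definition discrete_measure :: "real vec \<Rightarrow> real vec \<Rightarrow> real measure" where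
  "discrete_measure a x =
     measure_of UNIV (sets borel)
       (\<lambda>A. \<Sum>i<dim_vec x. ennreal (a $ i) * emeasure (return borel (x $ i)) A)"

definition quantile :: "real measure \<Rightarrow> real \<Rightarrow> real" where
  "quantile \<xi> u = Inf {t. u \<le> cdf \<xi> t}"

text \<open>
  \<^const>\<open>measure_of\<close> would yield the zero measure if the set function in
  \<^const>\<open>discrete_measure\<close> were not countably additive.
\<close>

lemma space_discrete_measure [simp]: "space (discrete_measure a x) = UNIV"
  by (simp add: discrete_measure_def space_measure_of_conv)

lemma sets_discrete_measure [simp]: "sets (discrete_measure a x) = sets borel"
  using sets.sets_measure_of_eq[of "borel :: real measure"] by (simp add: discrete_measure_def)

lemma emeasure_discrete_measure:
  assumes "A \<in> sets borel"
  shows "emeasure (discrete_measure a x) A =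
    (\<Sum>i<dim_vec x. ennreal (a $ i) * emeasure (return borel (x $ i)) A)"
proof (rule emeasure_measure_of[OF discrete_measure_def])
  show "countably_additive (sets (discrete_measure a x))
     (\<lambda>A. \<Sum>i<dim_vec x. ennreal (a $ i) * emeasure (return borel (x $ i)) A)"
  proof (rule countably_additiveI)
    fix B :: "nat \<Rightarrow> real set"
    assume B: "range B \<subseteq> sets (discrete_measure a x)" "disjoint_family B"
    have "(\<Sum>k. \<Sum>i<dim_vec x. ennreal (a $ i) * emeasure (return borel (x $ i)) (B k)) =
      (\<Sum>i<dim_vec x. \<Sum>k. ennreal (a $ i) * emeasure (return borel (x $ i)) (B k))"
      by (rule suminf_sum) simp
    also have "\<dots> = (\<Sum>i<dim_vec x. ennreal (a $ i) * emeasure (return borel (x $ i)) (\<Union>k. B k))"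
      using B by (simp add: suminf_emeasure del: emeasure_return)
    finally show "(\<Sum>k. \<Sum>i<dim_vec x. ennreal (a $ i) * emeasure (return borel (x $ i)) (B k)) =
      (\<Sum>i<dim_vec x. ennreal (a $ i) * emeasure (return borel (x $ i)) (\<Union>k. B k))" .
  qed
qed (use assms in \<open>auto simp: positive_def\<close>)

lemma prob_space_discrete_measure:
  assumes "\<And>i. i < dim_vec x \<Longrightarrow> 0 \<le> a $ i" "(\<Sum>i<dim_vec x. a $ i) = 1"
  shows "prob_space (discrete_measure a x)"
proof
  have "(\<Sum>i<dim_vec x. ennreal (a $ i)) = 1"
    using assms by (subst sum_ennreal) auto
  then show "emeasure (discrete_measure a x) (space (discrete_measure a x)) = 1"
    by (simp add: emeasure_discrete_measure)
qed

lemma sorting_perm_exists: "\<exists>\<sigma>. sorting_perm x \<sigma>"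
proof -
  define xs where "xs = map (($) x) [0..<dim_vec x]"
  have len: "length xs = dim_vec x" "length (sort xs) = dim_vec x" by (simp_all add: xs_def)
  have "mset (sort xs) = mset xs" by simp
  then obtain \<sigma> where \<sigma>: "\<sigma> permutes {..<length xs}" "permute_list \<sigma> xs = sort xs"
    by (rule mset_eq_permutation)
  have lt: "\<sigma> i < dim_vec x" if "i < dim_vec x" for i
    using permutes_in_image[OF \<sigma>(1), of i] that len by simp
  have "x $ \<sigma> i = sort xs ! i" if "i < dim_vec x" for i
    using that lt[OF that] \<sigma> permute_list_nth[OF \<sigma>(1), of i] len by (simp add: xs_def)
  then have "mono_on {..<dim_vec x} (($) (permute_vec x \<sigma>))"
    using len by (auto simp: monotone_on_def permute_vec_def intro!: sorted_nth_mono)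
  with \<sigma> len have "sorting_perm x \<sigma>"
    by (auto simp: sorting_perm_def increasing_vecs_def permute_vec_def)
  then show ?thesis by blast
qed

end

theory Submission
  imports Defs
begin

text \<open>
  Strict convexity of \<open>h\<close> makes \<open>h (y\<^sub>j - x\<^sub>i)\<close> strictly submodular, so moving a little mass off two
  crossing entries strictly decreases the cost and the support of an optimal plan is monotone.
  Rows and columns of a plan all carry mass \<open>1/n\<close>; counting the rows with
  \<open>x\<^sub>k \<le> S(x)\<^sub>j\<close> and those with \<open>x\<^sub>k \<ge> S(x)\<^sub>j\<close> then shows that column \<open>j\<close> only
  receives mass from rows with \<open>x\<^sub>i = S(x)\<^sub>j\<close>. This holds even if \<open>x\<close> has ties, when the plan itself
  is not unique; without ties the plan is \<open>1/n\<close> times a permutation matrix.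
\<close>

section \<open>Strict convexity and the exchange argument\<close>

text \<open>Both \<open>p\<close> and \<open>s + t - p\<close> are convex combinations of
  \<open>s\<close> and \<open>t\<close>, with the two weights swapped, so the two convexity
  inequalities add up to the claim.\<close>

lemma strictly_convex_sum_less:
  assumes "strictly_convex h" "s < p" "p < t"
  shows "h p + h (s + t - p) < h s + h t"
proof -
  define u where "u = (p - s) / (t - s)"
  have u: "0 < u" "u < 1" using assms(2,3) by (auto simp: u_def)
  have "u * (t - s) = p - s" using assms(2,3) by (simp add: u_def)
  then have p: "p = (1 - u) * s + u * t" by (simp add: algebra_simps)
  have q: "s + t - p = (1 - u) * t + u * s" unfolding p by (simp add: algebra_simps)
  have "h ((1 - u) * s + u * t) < (1 - u) * h s + u * h t"
    using assms u by (auto simp: strictly_convex_def)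
  moreover have "h ((1 - u) * t + u * s) < (1 - u) * h t + u * h s"
    using assms u by (auto simp: strictly_convex_def)
  ultimately have "h p + h (s + t - p) <
      ((1 - u) * h s + u * h t) + ((1 - u) * h t + u * h s)"
    unfolding q by (simp add: p)
  then show ?thesis by (simp add: algebra_simps)
qed

lemma mem_transport_polytope_iff:
  "P \<in> transport_polytope a b \<longleftrightarrow>
     P \<in> carrier_mat (dim_vec a) (dim_vec b) \<and>
     (\<forall>i < dim_vec a. \<forall>j < dim_vec b. 0 \<le> P $$ (i, j)) \<and>
     (\<forall>i < dim_vec a. (\<Sum>j<dim_vec b. P $$ (i, j)) = a $ i) \<and>
     (\<forall>j < dim_vec b. (\<Sum>i<dim_vec a. P $$ (i, j)) = b $ j)"
proof (cases "P \<in> carrier_mat (dim_vec a) (dim_vec b)")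
  case True
  then have "P *\<^sub>v ones_vec (dim_vec b) = a \<longleftrightarrow>
      (\<forall>i < dim_vec a. (\<Sum>j<dim_vec b. P $$ (i, j)) = a $ i)"
    by (auto simp: vec_eq_iff scalar_prod_def ones_vec_def atLeast0LessThan)
  moreover have "transpose_mat P *\<^sub>v ones_vec (dim_vec a) = b \<longleftrightarrow>
      (\<forall>j < dim_vec b. (\<Sum>i<dim_vec a. P $$ (i, j)) = b $ j)"
    using True by (auto simp: vec_eq_iff scalar_prod_def ones_vec_def atLeast0LessThan)
  ultimately show ?thesis
    by (simp add: transport_polytope_def)
qed (simp add: transport_polytope_def)

text \<open>Otherwise mass could be moved from \<open>(i, j)\<close> and \<open>(i', j')\<close> to
  \<open>(i, j')\<close> and \<open>(i', j)\<close>, keeping both marginals and lowering the cost.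
  For \<open>x $ i = x $ i'\<close> this move would not change the cost, hence the strict inequality
  in \<open>less\<close>.\<close>

lemma optimal_plan_support_mono:
  assumes h: "strictly_convex h"
    and dims: "dim_vec x = dim_vec a" "dim_vec y = dim_vec b"
    and y: "strictly_increasing_vec y"
    and opt: "is_arg_min (transport_cost h x y) (\<lambda>Q. Q \<in> transport_polytope a b) P"
    and idx: "i < dim_vec a" "i' < dim_vec a" "j < dim_vec b" "j' < dim_vec b"
    and pos: "0 < P $$ (i, j)" "0 < P $$ (i', j')"
    and less: "x $ i < x $ i'"
  shows "j \<le> j'"
proof (rule ccontr)
  assume "\<not> j \<le> j'"
  then have j: "j' < j" by simp
  then have yj: "y $ j' < y $ j"
    using y idx dims by (auto simp: strictly_increasing_vec_def monotone_on_def)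
  \<comment> \<open>The largest mass that can leave both crossing entries without making either
    negative.\<close>
  define e where "e = min (P $$ (i, j)) (P $$ (i', j'))"
  have e: "0 < e" using pos by (simp add: e_def)
  \<comment> \<open>The perturbation is \<open>e\<close> times the rank-one matrix with entries
    \<open>c k * d l\<close>. Both \<open>c\<close> and \<open>d\<close> sum to zero, so row and
    column sums do not change.\<close>
  define c :: "nat \<Rightarrow> real" where "c = (\<lambda>k. of_bool (k = i) - of_bool (k = i'))"
  define d :: "nat \<Rightarrow> real" where "d = (\<lambda>l. of_bool (l = j') - of_bool (l = j))"
  define Q where "Q = mat (dim_vec a) (dim_vec b) (\<lambda>(k, l). P $$ (k, l) + e * (c k * d l))"
  have ii: "i \<noteq> i'" using less by auto
  have csum: "(\<Sum>k<dim_vec a. c k * f k) = f i - f i'" for f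
    using idx by (simp add: c_def left_diff_distrib sum_subtractf)
  have dsum: "(\<Sum>l<dim_vec b. d l * f l) = f j' - f j" for f
    using idx by (simp add: d_def left_diff_distrib sum_subtractf)
  have P: "P \<in> transport_polytope a b" using opt by (simp add: is_arg_min_def)
  have "0 \<le> P $$ (k, l) + e * (c k * d l)" if "k < dim_vec a" "l < dim_vec b" for k l
  proof -
    have "0 \<le> P $$ (k, l)" using P that by (simp add: mem_transport_polytope_iff)
    then show ?thesis using e ii j by (auto simp: c_def d_def e_def)
  qed
  moreover have "(\<Sum>l<dim_vec b. P $$ (k, l) + e * (c k * d l)) = (\<Sum>l<dim_vec b. P $$ (k, l))" for k
    using dsum[of "\<lambda>_. 1"] by (simp add: sum.distrib flip: sum_distrib_left)
  moreover have "(\<Sum>k<dim_vec a. P $$ (k, l) + e * (c k * d l)) = (\<Sum>k<dim_vec a. P $$ (k, l))" for l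
    using csum[of "\<lambda>_. 1"] by (simp add: sum.distrib flip: sum_distrib_left sum_distrib_right)
  ultimately have "Q \<in> transport_polytope a b"
    using P by (simp add: mem_transport_polytope_iff Q_def)
  then have "transport_cost h x y P \<le> transport_cost h x y Q"
    using opt by (auto simp: is_arg_min_linorder)
  \<comment> \<open>The cost is linear in the plan; \<open>csum\<close> and \<open>dsum\<close>
    collapse the double sum to a mixed second difference of
    \<open>h (y $ l - x $ k)\<close>.\<close>
  moreover have "transport_cost h x y Q = transport_cost h x y P +
      e * (\<Sum>k<dim_vec a. c k * (\<Sum>l<dim_vec b. d l * h (y $ l - x $ k)))"
    by (simp add: transport_cost_def dims Q_def algebra_simps sum.distrib sum_distrib_left)
  ultimately have "0 \<le> e * (\<Sum>k<dim_vec a. c k * (\<Sum>l<dim_vec b. d l * h (y $ l - x $ k)))"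
    by simp
  then have "0 \<le> (h (y $ j' - x $ i) - h (y $ j - x $ i)) - (h (y $ j' - x $ i') - h (y $ j - x $ i'))"
    using e unfolding csum dsum by (simp add: zero_le_mult_iff)
  \<comment> \<open>The outer points are \<open>y $ j' - x $ i'\<close> and
    \<open>y $ j - x $ i\<close>. The other two differences lie strictly between them and have the
    same sum.\<close>
  moreover have "h (y $ j' - x $ i) + h (y $ j - x $ i') < h (y $ j' - x $ i') + h (y $ j - x $ i)"
    using strictly_convex_sum_less[OF h, of "y $ j' - x $ i'" "y $ j' - x $ i" "y $ j - x $ i"]
      less yj by (simp add: algebra_simps)
  ultimately show False by simp
qed

section \<open>Counting entries below and above a sorted value\<close>

lemma permute_sorted_le:
  assumes "sorting_perm x \<sigma>" "k \<le> l" "l < dim_vec x"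
  shows "x $ \<sigma> k \<le> x $ \<sigma> l"
  using assms by (force simp: sorting_perm_def increasing_vecs_def permute_vec_def monotone_on_def)

lemma sorting_perm_less:
  assumes "sorting_perm x \<sigma>" "k < dim_vec x"
  shows "\<sigma> k < dim_vec x"
  using assms permutes_in_image[of \<sigma> "{..<dim_vec x}" k] by (auto simp: sorting_perm_def)

text \<open>The sorted positions \<open>0, ..., j\<close> supply \<open>Suc j\<close> distinct
  indices; ties can make the count larger.\<close>

lemma card_le_ge:
  assumes \<sigma>: "sorting_perm x \<sigma>" and j: "j < dim_vec x" and t: "x $ \<sigma> j \<le> t"
  shows "Suc j \<le> card {k. k < dim_vec x \<and> x $ k \<le> t}"
proof -
  have "\<sigma> ` {..j} \<subseteq> {k. k < dim_vec x \<and> x $ k \<le> t}"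
    using permute_sorted_le[OF \<sigma>] sorting_perm_less[OF \<sigma>] j t by force
  moreover have "inj \<sigma>" using \<sigma> permutes_inj by (auto simp: sorting_perm_def)
  ultimately show ?thesis
    using card_mono[of "{k. k < dim_vec x \<and> x $ k \<le> t}" "\<sigma> ` {..j}"]
    by (simp add: card_image inj_on_subset)
qed

lemma card_ge_ge:
  assumes \<sigma>: "sorting_perm x \<sigma>" and j: "j < dim_vec x" and t: "t \<le> x $ \<sigma> j"
  shows "dim_vec x - j \<le> card {k. k < dim_vec x \<and> t \<le> x $ k}"
proof -
  have "\<sigma> ` {j..<dim_vec x} \<subseteq> {k. k < dim_vec x \<and> t \<le> x $ k}"
    using permute_sorted_le[OF \<sigma>] sorting_perm_less[OF \<sigma>] t by force
  moreover have "inj \<sigma>" using \<sigma> permutes_inj by (auto simp: sorting_perm_def)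
  ultimately show ?thesis
    using card_mono[of "{k. k < dim_vec x \<and> t \<le> x $ k}" "\<sigma> ` {j..<dim_vec x}"]
    by (simp add: card_image inj_on_subset)
qed

text \<open>This makes \<open>x $ \<sigma> j\<close> the least threshold whose count reaches
  \<open>Suc j\<close>, which is what the quantile formula needs. Below that threshold only the
  \<open>j\<close> earlier sorted positions can be counted.\<close>

lemma card_le_ge_iff:
  assumes \<sigma>: "sorting_perm x \<sigma>" and j: "j < dim_vec x"
  shows "Suc j \<le> card {k. k < dim_vec x \<and> x $ k \<le> t} \<longleftrightarrow> x $ \<sigma> j \<le> t"
proof
  assume *: "Suc j \<le> card {k. k < dim_vec x \<and> x $ k \<le> t}"
  show "x $ \<sigma> j \<le> t"
  proof (rule ccontr)
    assume t: "\<not> x $ \<sigma> j \<le> t"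
    have "{k. k < dim_vec x \<and> x $ k \<le> t} \<subseteq> \<sigma> ` {..<j}"
    proof
      fix k assume k: "k \<in> {k. k < dim_vec x \<and> x $ k \<le> t}"
      then have "k \<in> \<sigma> ` {..<dim_vec x}"
        using \<sigma> permutes_image by (fastforce simp: sorting_perm_def)
      then obtain l where l: "l < dim_vec x" "k = \<sigma> l" by auto
      have "l < j" using permute_sorted_le[OF \<sigma>, of j l] l k t by force
      then show "k \<in> \<sigma> ` {..<j}" using l by auto
    qed
    then have "card {k. k < dim_vec x \<and> x $ k \<le> t} \<le> card (\<sigma> ` {..<j})"
      by (intro card_mono) auto
    also have "\<dots> \<le> j" using card_image_le[of "{..<j}" \<sigma>] by simp
    finally show False using * by simp
  qed
qed (use card_le_ge[OF \<sigma> j] in simp)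

section \<open>Mass balance and the columns of an optimal plan\<close>

text \<open>The rows in \<open>A\<close> send their whole mass \<open>card A * w\<close> into the
  columns in \<open>B\<close>, whose capacity \<open>card B * w\<close> is no larger. These columns
  are then full, and nothing is left for a row outside \<open>A\<close>.\<close>

lemma uniform_plan_saturated:
  fixes p :: "nat \<Rightarrow> nat \<Rightarrow> real"
  assumes "\<And>i j. i < n \<Longrightarrow> j < n \<Longrightarrow> 0 \<le> p i j"
    and row: "\<And>i. i < n \<Longrightarrow> (\<Sum>j<n. p i j) = w"
    and col: "\<And>j. j < n \<Longrightarrow> (\<Sum>i<n. p i j) = w"
    and A: "A \<subseteq> {..<n}" and B: "B \<subseteq> {..<n}" and card: "card B \<le> card A" and w: "0 \<le> w"
    and supp: "\<And>i j. i \<in> A \<Longrightarrow> j < n \<Longrightarrow> 0 < p i j \<Longrightarrow> j \<in> B"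
    and i: "i < n" "i \<notin> A" and j: "j \<in> B"
  shows "p i j = 0"
proof -
  have fin: "finite A" "finite B" using A B finite_subset by auto
  have nonneg: "0 \<le> p k l" if "k < n" "l < n" for k l using assms that by blast
  have "card A * w = (\<Sum>k\<in>A. \<Sum>l<n. p k l)" using A row by (simp add: subset_eq)
  also have "\<dots> = (\<Sum>k\<in>A. \<Sum>l\<in>B. p k l)"
  proof (rule sum.cong[OF refl], rule sum.mono_neutral_right)
    fix k assume "k \<in> A"
    then show "\<forall>l\<in>{..<n} - B. p k l = 0"
      using supp[of k] nonneg[of k] A by (force simp: order.order_iff_strict)
  qed (use B in auto)
  also have "\<dots> = (\<Sum>l\<in>B. \<Sum>k\<in>A. p k l)" by (rule sum.swap)
  finally have A_mass: "(\<Sum>l\<in>B. \<Sum>k\<in>A. p k l) = card A * w" ..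
  have "(\<Sum>l\<in>B. \<Sum>k\<in>{..<n}. p k l) = card B * w" using B col by (simp add: subset_eq)
  moreover have "(\<Sum>k<n. p k l) = (\<Sum>k\<in>A. p k l) + (\<Sum>k\<in>{..<n} - A. p k l)" for l
    using sum.subset_diff[OF A] by (simp add: add.commute)
  \<comment> \<open>The mass reaching \<open>B\<close> from outside \<open>A\<close> is the capacity
    of \<open>B\<close> minus what \<open>A\<close> sends there.\<close>
  ultimately have "(\<Sum>l\<in>B. \<Sum>k\<in>{..<n} - A. p k l) = card B * w - card A * w"
    using A_mass by (simp add: sum.distrib)
  also have "\<dots> \<le> 0" using card w by (simp add: mult_right_mono)
  finally have "(\<Sum>l\<in>B. \<Sum>k\<in>{..<n} - A. p k l) \<le> 0" .
  moreover have B_nonneg: "0 \<le> (\<Sum>k\<in>{..<n} - A. p k l)" if "l \<in> B" for l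
    using nonneg that B by (intro sum_nonneg) auto
  ultimately have "(\<Sum>k\<in>{..<n} - A. p k j) = 0"
    using sum_nonneg_eq_0_iff[OF fin(2) B_nonneg] j sum_nonneg[of B, OF B_nonneg] by force
  moreover have "p i j \<le> (\<Sum>k\<in>{..<n} - A. p k j)"
    using i j B nonneg by (intro member_le_sum) auto
  ultimately show ?thesis using nonneg[of i j] i j B by force
qed

text \<open>The sorted value \<open>x $ \<sigma> j\<close> serves as a threshold: a row on the wrong
  side of it finds column \<open>j\<close> already filled by the rows on the other side. With ties
  only the value \<open>x $ i\<close> is determined, not the index \<open>i\<close>.\<close>

lemma optimal_plan_column_support:
  assumes h: "strictly_convex h"
    and x: "x \<in> carrier_vec n" and y: "y \<in> carrier_vec n" "strictly_increasing_vec y"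
    and w: "0 \<le> w"
    and opt: "is_arg_min (transport_cost h x y)
      (\<lambda>Q. Q \<in> transport_polytope (w \<cdot>\<^sub>v ones_vec n) (w \<cdot>\<^sub>v ones_vec n)) P"
    and \<sigma>: "sorting_perm x \<sigma>"
    and idx: "i < n" "j < n" and pos: "0 < P $$ (i, j)"
  shows "x $ i = x $ \<sigma> j"
proof -
  have dims [simp]: "dim_vec x = n" "dim_vec y = n" "dim_vec (ones_vec n) = n"
    using x y by (auto simp: ones_vec_def)
  have "P \<in> transport_polytope (w \<cdot>\<^sub>v ones_vec n) (w \<cdot>\<^sub>v ones_vec n)"
    using opt by (simp add: is_arg_min_def)
  then have nonneg: "\<And>k l. k < n \<Longrightarrow> l < n \<Longrightarrow> 0 \<le> P $$ (k, l)"
    and row: "\<And>k. k < n \<Longrightarrow> (\<Sum>l<n. P $$ (k, l)) = w"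
    and col: "\<And>l. l < n \<Longrightarrow> (\<Sum>k<n. P $$ (k, l)) = w"
    by (auto simp: mem_transport_polytope_iff ones_vec_def)
  note saturated = uniform_plan_saturated[of n "\<lambda>k l. P $$ (k, l)", OF nonneg row col _ _ _ w]
  have supp: "l \<le> l'"
    if "k < n" "k' < n" "l < n" "l' < n" "0 < P $$ (k, l)" "0 < P $$ (k', l')" "x $ k < x $ k'"
    for k k' l l'
    using optimal_plan_support_mono[OF h _ _ y(2) opt, of k k' l l'] that by simp
  have "\<not> x $ \<sigma> j < x $ i"
  proof
    assume gt: "x $ \<sigma> j < x $ i"
    have "P $$ (i, j) = 0"
    \<comment> \<open>Rows with value at most \<open>x $ \<sigma> j\<close> lie strictly below row
      \<open>i\<close>, so monotone support confines them to the columns \<open>0, ..., j\<close>,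
      and there are at least \<open>Suc j\<close> such rows.\<close>
    proof (rule saturated[of "{k. k < n \<and> x $ k \<le> x $ \<sigma> j}" "{..j}"])
      show "card {..j} \<le> card {k. k < n \<and> x $ k \<le> x $ \<sigma> j}"
        using card_le_ge[OF \<sigma>, of j] idx by simp
      show "l \<in> {..j}" if "k \<in> {k. k < n \<and> x $ k \<le> x $ \<sigma> j}" "l < n" "0 < P $$ (k, l)" for k l
        using supp[of k i l j] that idx pos gt by auto
    qed (use idx gt in auto)
    then show False using pos by simp
  qed
  moreover have "\<not> x $ i < x $ \<sigma> j"
  proof
    assume lt: "x $ i < x $ \<sigma> j"
    have "P $$ (i, j) = 0"
    \<comment> \<open>The mirror image: at least \<open>n - j\<close> rows lie above row
      \<open>i\<close> and are confined to the last \<open>n - j\<close> columns.\<close>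
    proof (rule saturated[of "{k. k < n \<and> x $ \<sigma> j \<le> x $ k}" "{j..<n}"])
      show "card {j..<n} \<le> card {k. k < n \<and> x $ \<sigma> j \<le> x $ k}"
        using card_ge_ge[OF \<sigma>, of j] idx by simp
      show "l \<in> {j..<n}" if "k \<in> {k. k < n \<and> x $ \<sigma> j \<le> x $ k}" "l < n" "0 < P $$ (k, l)" for k l
        using supp[of i k j l] that idx pos lt by auto
    qed (use idx lt in auto)
    then show False using pos by simp
  qed
  ultimately show ?thesis by simp
qed

section \<open>Distribution function, ranks and sorted values\<close>

lemma cdf_discrete_measure_uniform:
  assumes "0 \<le> w"
  shows "cdf (discrete_measure (w \<cdot>\<^sub>v ones_vec (dim_vec x)) x) t =
    w * card {k. k < dim_vec x \<and> x $ k \<le> t}"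
proof -
  have "emeasure (discrete_measure (w \<cdot>\<^sub>v ones_vec (dim_vec x)) x) {..t} =
      (\<Sum>i<dim_vec x. ennreal (w * indicator {..t} (x $ i)))"
    unfolding emeasure_discrete_measure[OF borel_closed[OF closed_atMost]]
    by (intro sum.cong) (auto simp: ones_vec_def indicator_def)
  also have "\<dots> = ennreal (\<Sum>i<dim_vec x. w * indicator {..t} (x $ i))"
    using assms by (intro sum_ennreal) auto
  also have "(\<Sum>i<dim_vec x. w * indicator {..t} (x $ i)) =
      w * card {k. k < dim_vec x \<and> x $ k \<le> t}"
  proof -
    have "{..<dim_vec x} \<inter> {k. x $ k \<le> t} = {k. k < dim_vec x \<and> x $ k \<le> t}" by auto
    then show ?thesis by (simp add: indicator_def flip: sum_distrib_left)
  qed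
  finally show ?thesis using assms by (simp add: cdf_def measure_def)
qed

text \<open>The rank identities are stated for distinct entries: with ties
  \<open>inv \<sigma>\<close> is still injective, whereas \<open>cdf \<xi>\<close> agrees at equal
  entries. The sorting identities concern values only and hold for every sorting
  permutation.\<close>

theorem proposition2:
  fixes n :: nat and x y a b :: "real vec" and \<xi> :: "real measure"
    and h :: "real \<Rightarrow> real" and P :: "real mat" and \<sigma> :: "nat \<Rightarrow> nat"
  assumes "n \<ge> 1"
    and "x \<in> carrier_vec n"
    and "a = (1 / real n) \<cdot>\<^sub>v ones_vec n"
    and "b = (1 / real n) \<cdot>\<^sub>v ones_vec n"
    and "\<xi> = discrete_measure a x"
    and "strictly_convex h" and "\<And>t. 0 \<le> h t"
    and "y \<in> increasing_vecs n" and "strictly_increasing_vec y"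
    and "is_arg_min (transport_cost h x y) (\<lambda>Q. Q \<in> transport_polytope a b) P"
    and "sorting_perm x \<sigma>"
  shows
    "(inj_on (($) x) {..<n} \<longrightarrow>
        perm_vec n (Hilbert_Choice.inv \<sigma>) = (real n)\<^sup>2 \<cdot>\<^sub>v (P *\<^sub>v cumsum_vec b) \<and>
        perm_vec n (Hilbert_Choice.inv \<sigma>) = real n \<cdot>\<^sub>v (P *\<^sub>v vec n (\<lambda>i. real (Suc i))) \<and>
        perm_vec n (Hilbert_Choice.inv \<sigma>) = real n \<cdot>\<^sub>v map_vec (cdf \<xi>) x \<and>
        strictly_increasing_vec (permute_vec x \<sigma>)) \<and>
     permute_vec x \<sigma> = real n \<cdot>\<^sub>v (transpose_mat P *\<^sub>v x) \<and>
     permute_vec x \<sigma> = map_vec (quantile \<xi>) (cumsum_vec b) \<and>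
     permute_vec x \<sigma> \<in> increasing_vecs n"
proof -
  note n = assms(1)
  have dims [simp]: "dim_vec x = n" "dim_vec y = n" "dim_vec (ones_vec n) = n"
    using assms by (auto simp: ones_vec_def increasing_vecs_def)
  note \<sigma> = assms(11)
  have perm: "\<sigma> permutes {..<n}" using \<sigma> by (simp add: sorting_perm_def)
  have \<sigma>_less: "\<sigma> j < n" if "j < n" for j using sorting_perm_less[OF \<sigma>] that by simp
  have \<tau>_less: "Hilbert_Choice.inv \<sigma> i < n" if "i < n" for i
    using permutes_in_image[OF permutes_inv[OF perm], of i] that by simp
  have incr: "permute_vec x \<sigma> \<in> increasing_vecs n" using \<sigma> by (simp add: sorting_perm_def)
  have "P \<in> transport_polytope a b" using assms(10) by (simp add: is_arg_min_def)
  then have P: "P \<in> carrier_mat n n"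
    and nonneg: "\<And>k l. k < n \<Longrightarrow> l < n \<Longrightarrow> 0 \<le> P $$ (k, l)"
    and col: "\<And>l. l < n \<Longrightarrow> (\<Sum>k<n. P $$ (k, l)) = 1 / real n"
    by (auto simp: mem_transport_polytope_iff assms(3,4) ones_vec_def)
  have supp: "x $ i = x $ \<sigma> j" if "i < n" "j < n" "P $$ (i, j) \<noteq> 0" for i j
  proof (rule optimal_plan_column_support[OF assms(6,2) _ assms(9) _ _ \<sigma> that(1,2)])
    show "y \<in> carrier_vec n" using assms(8) by (simp add: increasing_vecs_def)
    show "0 \<le> 1 / real n" by simp
    show "is_arg_min (transport_cost h x y) (\<lambda>Q. Q \<in> transport_polytope
        ((1 / real n) \<cdot>\<^sub>v ones_vec n) ((1 / real n) \<cdot>\<^sub>v ones_vec n)) P"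
      using assms(10) unfolding assms(3,4) .
    show "0 < P $$ (i, j)" using nonneg[OF that(1,2)] that(3) by simp
  qed
  have cumsum: "cumsum_vec b = vec n (\<lambda>i. real (Suc i) / real n)"
    by (auto simp: cumsum_vec_def assms(4) ones_vec_def)
  have cdf: "cdf \<xi> t = card {k. k < n \<and> x $ k \<le> t} / real n" for t
    using cdf_discrete_measure_uniform[of "1 / real n" x t] by (simp add: assms(3,5))
  \<comment> \<open>Column \<open>j\<close> has mass \<open>1 / n\<close>, all on rows with the
    value \<open>x $ \<sigma> j\<close>, so that value factors out.\<close>
  have "(\<Sum>i<n. P $$ (i, j) * x $ i) = x $ \<sigma> j / real n" if "j < n" for j
  proof -
    have "(\<Sum>i<n. P $$ (i, j) * x $ i) = (\<Sum>i<n. P $$ (i, j) * x $ \<sigma> j)"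
      using supp that by (intro sum.cong) auto
    then show ?thesis using col that by (simp flip: sum_distrib_right)
  qed
  then have S_plan: "permute_vec x \<sigma> = real n \<cdot>\<^sub>v (transpose_mat P *\<^sub>v x)"
    using P n by (auto simp: vec_eq_iff permute_vec_def scalar_prod_def atLeast0LessThan)
  have "quantile \<xi> (real (Suc j) / real n) = x $ \<sigma> j" if "j < n" for j
  proof -
    \<comment> \<open>The set is a closed half-line, so its infimum is its left endpoint.\<close>
    have "{t. real (Suc j) / real n \<le> cdf \<xi> t} = {x $ \<sigma> j..}"
      using card_le_ge_iff[OF \<sigma>, of j] that n
      by (auto simp: cdf divide_le_cancel simp del: of_nat_Suc)
    then show ?thesis by (simp add: quantile_def del: of_nat_Suc)
  qed
  then have S_quantile: "permute_vec x \<sigma> = map_vec (quantile \<xi>) (cumsum_vec b)"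
    by (auto simp: vec_eq_iff permute_vec_def cumsum simp del: of_nat_Suc)
  have "perm_vec n (Hilbert_Choice.inv \<sigma>) = (real n)\<^sup>2 \<cdot>\<^sub>v (P *\<^sub>v cumsum_vec b) \<and>
      perm_vec n (Hilbert_Choice.inv \<sigma>) = real n \<cdot>\<^sub>v (P *\<^sub>v vec n (\<lambda>i. real (Suc i))) \<and>
      perm_vec n (Hilbert_Choice.inv \<sigma>) = real n \<cdot>\<^sub>v map_vec (cdf \<xi>) x \<and>
      strictly_increasing_vec (permute_vec x \<sigma>)" if inj: "inj_on (($) x) {..<n}"
  proof -
    have \<sigma>_inv: "\<sigma> (Hilbert_Choice.inv \<sigma> i) = i" "Hilbert_Choice.inv \<sigma> (\<sigma> i) = i" for i
      using permutes_inverses[OF perm] by auto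
    have strict: "x $ \<sigma> k < x $ \<sigma> l \<longleftrightarrow> k < l" if "k < n" "l < n" for k l
    proof -
      have "x $ \<sigma> k = x $ \<sigma> l \<longleftrightarrow> k = l"
        using inj_on_eq_iff[OF inj, of "\<sigma> k" "\<sigma> l"] \<sigma>_less that \<sigma>_inv by (metis lessThan_iff)
      then show ?thesis
        using permute_sorted_le[OF \<sigma>, of k l] permute_sorted_le[OF \<sigma>, of l k] that
        by (cases k l rule: linorder_cases) auto
    qed
    \<comment> \<open>Injectivity turns equality of values in \<open>supp\<close> into equality of
      indices. One entry per column survives and carries the column sum \<open>1 / n\<close>, so
      \<open>P\<close> is a scaled permutation matrix.\<close>
    have zero: "P $$ (i, j) = 0" if "i < n" "j < n" "i \<noteq> \<sigma> j" for i j
      using supp[of i j] inj_on_eq_iff[OF inj, of i "\<sigma> j"] \<sigma>_less that by auto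
    have entry: "P $$ (i, j) = (if j = Hilbert_Choice.inv \<sigma> i then 1 / real n else 0)"
      if "i < n" "j < n" for i j
    proof (cases "i = \<sigma> j")
      case True
      have "(\<Sum>k<n. P $$ (k, j)) = (\<Sum>k<n. if k = i then P $$ (i, j) else 0)"
        using zero that True by (intro sum.cong) auto
      then show ?thesis using col that True \<sigma>_inv by simp
    qed (use zero that \<sigma>_inv in auto)
    have row_sum: "(\<Sum>j<n. P $$ (i, j) * f j) = f (Hilbert_Choice.inv \<sigma> i) / real n" if "i < n" for i f
    proof -
      have "(\<Sum>j<n. P $$ (i, j) * f j) =
          (\<Sum>j<n. if j = Hilbert_Choice.inv \<sigma> i then f j / real n else 0)"
        using entry that by (intro sum.cong) auto
      then show ?thesis using \<tau>_less that by simp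
    qed
    \<comment> \<open>A general \<open>f\<close> covers both the vector of ranks and
      \<open>cumsum_vec b\<close>; the latter has a further factor \<open>1 / n\<close>, which
      accounts for \<open>(real n)\<^sup>2\<close>.\<close>
    have P_vec: "P *\<^sub>v vec n f = vec n (\<lambda>i. f (Hilbert_Choice.inv \<sigma> i) / real n)" for f
      using P row_sum by (auto simp: vec_eq_iff scalar_prod_def atLeast0LessThan)
    \<comment> \<open>Without ties the entries up to \<open>x $ i\<close> occupy exactly the sorted
      positions \<open>0, ..., inv \<sigma> i\<close>. Their number is the rank counted from 1, as
      in \<open>perm_vec\<close>.\<close>
    have card: "card {k. k < n \<and> x $ k \<le> x $ i} = Suc (Hilbert_Choice.inv \<sigma> i)" if "i < n" for i
    proof -
      have "k < n \<and> x $ k \<le> x $ i \<longleftrightarrow> k \<in> \<sigma> ` {..Hilbert_Choice.inv \<sigma> i}" for k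
      proof -
        have "x $ k \<le> x $ i \<longleftrightarrow> Hilbert_Choice.inv \<sigma> k \<le> Hilbert_Choice.inv \<sigma> i" if "k < n"
          using strict[OF \<tau>_less[OF \<open>i < n\<close>] \<tau>_less[OF that]] \<sigma>_inv by (simp flip: not_less)
        moreover have "k \<in> \<sigma> ` {..l} \<longleftrightarrow> Hilbert_Choice.inv \<sigma> k \<le> l" for l
          using \<sigma>_inv by (metis atMost_iff imageE imageI)
        moreover have "k < n" if "Hilbert_Choice.inv \<sigma> k \<le> Hilbert_Choice.inv \<sigma> i"
          using \<sigma>_less[of "Hilbert_Choice.inv \<sigma> k"] \<tau>_less[OF \<open>i < n\<close>] that \<sigma>_inv by simp
        ultimately show ?thesis by auto
      qed
      then have "{k. k < n \<and> x $ k \<le> x $ i} = \<sigma> ` {..Hilbert_Choice.inv \<sigma> i}" by blast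
      then show ?thesis using permutes_inj[OF perm] by (simp add: card_image inj_on_subset)
    qed
    show ?thesis
      using n card strict
      by (auto simp: vec_eq_iff perm_vec_def cumsum P_vec cdf power2_eq_square permute_vec_def
          strictly_increasing_vec_def monotone_on_def)
  qed
  then show ?thesis using S_plan S_quantile incr by blast
qed

end
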